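(* Let $d\geq 2$ and fix any $a\in\mathbb{C}\setminus\{0\}$. Then there is a generic, in particular dense, subset $\mathcal{E}\subset\mathbb{C}^{2d-2}$ of configurations $(e_1,\dots,e_d,e_{-1},\dots,e_{-(d-2)})$ such that for every configuration in $\mathcal{E}$ the rational vector field $f=P/Q$ with $P(w)=a(w-e_1)\cdots(w-e_d)$ and $Q(w)=(w-e_{-1})\cdots(w-e_{-(d-2)})$ is nondegenerate.
   Context: A subset of $\mathbb{C}^{2d-2}$ is generic if it is a countable intersection of open dense subsets. With $E=\{e_j\}_{j=1}^d$, $E'=\{e_{-j'}\}_{j'=1}^{d'}$, $d'=\deg Q$, $\eta_j := 1/f'(e_j)$, $\omega := dw/f$, and $\mathcal{P} := 2\pi i\,\langle \eta_1,\dots,\eta_d\rangle_{\mathbb{Z}}$, the field $f=P/Q$ is nondegenerate if: (i) all zeros of $P$ and $Q$ are simple, $E\cap E'=\emptyset$, and $d'=d-2\geq 0$; (ii) no $e_j\in E$ lies on a straight line through two distinct poles in $E'$; (iii) $\mathrm{Re}\sum_{j\in J}\eta_j\neq0$ for every $\emptyset\neq J\subsetneq\{1,\dots,d\}$; (iv) for every straight segment $\Gamma_0$ joining two distinct poles, $\int_{\Gamma_0}\omega\notin\mathbb{R}+\mathcal{P}$. *)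

theory Defs
  imports "HOL-Complex_Analysis.Complex_Analysis" "HOL-Computational_Algebra.Polynomial"
begin

definition generic :: "'a::topological_space set \<Rightarrow> bool" where
  "generic E \<longleftrightarrow> (\<exists>F. countable F \<and> (\<forall>U\<in>F. open U \<and> closure U = UNIV) \<and> E = \<Inter>F)"

definition numP :: "complex \<Rightarrow> nat \<Rightarrow> (nat \<Rightarrow> complex) \<Rightarrow> complex poly" where
  "numP a d e = smult a (\<Prod>j\<in>{1..d}. [:- e j, 1:])"

definition denQ :: "nat \<Rightarrow> (nat \<Rightarrow> complex) \<Rightarrow> complex poly" where
  "denQ d p = (\<Prod>j\<in>{1..d-2}. [:- p j, 1:])"

definition fieldf :: "complex \<Rightarrow> nat \<Rightarrow> (nat \<Rightarrow> complex) \<Rightarrow> (nat \<Rightarrow> complex) \<Rightarrow> complex \<Rightarrow> complex" where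
  "fieldf a d e p w = poly (numP a d e) w / poly (denQ d p) w"

definition eta :: "complex \<Rightarrow> nat \<Rightarrow> (nat \<Rightarrow> complex) \<Rightarrow> (nat \<Rightarrow> complex) \<Rightarrow> nat \<Rightarrow> complex" where
  "eta a d e p j = 1 / deriv (fieldf a d e p) (e j)"

definition realPlusPeriods :: "complex \<Rightarrow> nat \<Rightarrow> (nat \<Rightarrow> complex) \<Rightarrow> (nat \<Rightarrow> complex) \<Rightarrow> complex set" where
  "realPlusPeriods a d e p =
     {complex_of_real r + 2 * complex_of_real pi * \<i> * (\<Sum>j\<in>{1..d}. of_int (n j) * eta a d e p j)
      | r n. r \<in> (UNIV::real set) \<and> n \<in> (UNIV :: (nat \<Rightarrow> int) set)}"

definition nondegenerate :: "complex \<Rightarrow> nat \<Rightarrow> (nat \<Rightarrow> complex) \<Rightarrow> (nat \<Rightarrow> complex) \<Rightarrow> bool" where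
  "nondegenerate a d e p \<longleftrightarrow>
     \<comment> \<open>(i)\<close>
     (rsquarefree (numP a d e) \<and> rsquarefree (denQ d p) \<and>
      e ` {1..d} \<inter> p ` {1..d-2} = {} \<and> d \<ge> 2 \<and> degree (denQ d p) = d - 2) \<and>
     \<comment> \<open>(ii)\<close>
     (\<forall>j\<in>{1..d}. \<forall>k\<in>{1..d-2}. \<forall>l\<in>{1..d-2}. p k \<noteq> p l \<longrightarrow>
        (\<forall>t::real. e j \<noteq> p k + complex_of_real t * (p l - p k))) \<and>
     \<comment> \<open>(iii)\<close>
     (\<forall>J. J \<noteq> {} \<and> J \<subset> {1..d} \<longrightarrow> Re (\<Sum>j\<in>J. eta a d e p j) \<noteq> 0) \<and>
     \<comment> \<open>(iv)\<close>
     (\<forall>k\<in>{1..d-2}. \<forall>l\<in>{1..d-2}. p k \<noteq> p l \<longrightarrow>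
        contour_integral (linepath (p k) (p l)) (\<lambda>w. 1 / fieldf a d e p w)
          \<notin> realPlusPeriods a d e p)"

end

theory Submission
  imports Defs
begin

text \<open>Each nondegeneracy condition follows from \<open>Im h \<noteq> 0\<close> for certain functions \<open>h\<close> of the
configuration, each continuous and, along one suitable coordinate, holomorphic and nonconstant.
By the open mapping theorem \<open>Im h \<noteq> 0\<close> holds on an open dense set. Condition (ii) follows by
moving \<open>e\<^sub>j\<close>. For (iii) one moves a zero \<open>e\<^sub>i\<close> with \<open>i \<notin> J\<close>: the sum of the residues over \<open>J\<close> is
a sum of simple poles in \<open>e\<^sub>i\<close>. For (iv) one moves an endpoint \<open>z\<close> of the segment: \<open>1/f\<close> equals
\<open>(w - z) T(w)\<close> with \<open>T\<close> independent of \<open>z\<close>, so the periods are affine in \<open>z\<close>, while the integral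
over the segment has second derivative \<open>T(z) \<noteq> 0\<close>. There are countably many periods.\<close>

no_notation fps_nth (infixl "$" 75)

section \<open>Changing one coordinate of a vector\<close>

definition vec_upd :: "'a ^ 'n \<Rightarrow> 'n \<Rightarrow> 'a \<Rightarrow> 'a ^ 'n" where
  "vec_upd x m z = (\<chi> i. if i = m then z else x $ i)"

lemma vec_upd_nth [simp]: "vec_upd x m z $ i = (if i = m then z else x $ i)"
  by (simp add: vec_upd_def)

lemma dist_vec_upd:
  fixes x :: "'a::real_normed_vector ^ 'n"
  shows "dist x (vec_upd x m z) = dist (x $ m) z"
proof -
  have "dist x (vec_upd x m z) = L2_set (\<lambda>i. if i = m then dist (x $ m) z else 0) UNIV"
    unfolding dist_vec_def by (intro L2_set_cong) auto
  also have "\<dots> = dist (x $ m) z"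
    by (simp add: L2_set_def if_distrib[of "\<lambda>u. u\<^sup>2"] cong: if_cong)
  finally show ?thesis .
qed

section \<open>Open dense sets and generic sets\<close>

definition open_dense :: "'a::topological_space set \<Rightarrow> bool" where
  "open_dense U \<longleftrightarrow> open U \<and> closure U = UNIV"

text \<open>Openness of \<open>U\<close> lets the dense set \<open>V\<close> meet every nonempty
  open part of \<open>U\<close>, so \<open>U \<inter> V\<close> is dense in \<open>U\<close> and
  hence everywhere.\<close>

lemma open_dense_Int:
  assumes "open_dense U" "open_dense V"
  shows "open_dense (U \<inter> V)"
  using assms closure_open_Int_superset[of U V] by (auto simp: open_dense_def)

lemma open_dense_superset:
  assumes "open_dense U" "U \<subseteq> V" "open V"
  shows "open_dense V"
  using assms closure_mono[OF assms(2)] by (simp add: open_dense_def top.extremum_unique)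

lemma open_dense_INT:
  assumes "finite I" "\<And>i. i \<in> I \<Longrightarrow> open_dense (U i)"
  shows "open_dense (\<Inter>i\<in>I. U i)"
  using assms
  by (induction I rule: finite_induct) (auto simp: open_dense_Int, simp add: open_dense_def)

lemma generic_INT:
  assumes "countable I" "\<And>i. i \<in> I \<Longrightarrow> open_dense (U i)"
  shows "generic (\<Inter>i\<in>I. U i)"
  unfolding generic_def using assms
  by (intro exI[of _ "U ` I"]) (auto simp: open_dense_def)

lemma generic_Int:
  assumes "generic U" "generic V"
  shows "generic (U \<inter> V)"
proof -
  obtain F G where "countable F" "\<forall>U\<in>F. open U \<and> closure U = UNIV" "U = \<Inter>F"
    "countable G" "\<forall>U\<in>G. open U \<and> closure U = UNIV" "V = \<Inter>G"
    using assms unfolding generic_def by blast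
  then show ?thesis
    unfolding generic_def by (intro exI[of _ "F \<union> G"]) auto
qed

section \<open>Nonreal values of holomorphic functions\<close>

text \<open>A nonconstant \<open>f\<close> would have an open image, which together with a real
  value \<open>f z\<close> contains a point slightly above it in the imaginary direction.\<close>

lemma real_holomorphic_constant:
  assumes holf: "f holomorphic_on S" and S: "open S" "connected S"
    and Im0: "\<And>z. z \<in> S \<Longrightarrow> Im (f z) = 0"
  shows "f constant_on S"
proof (rule ccontr)
  assume nc: "\<not> f constant_on S"
  then obtain z where z: "z \<in> S"
    by (auto simp: constant_on_def)
  have "open (f ` S)"
    by (rule open_mapping_thm[OF holf S S(1) order_refl nc])
  then obtain e where e: "e > 0" "ball (f z) e \<subseteq> f ` S"
    using z by (meson imageI open_contains_ball)
  have "f z + \<i> * of_real (e/2) \<in> ball (f z) e"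
    using e(1) by (simp add: dist_norm norm_mult)
  then obtain y where "y \<in> S" "f y = f z + \<i> * of_real (e/2)"
    using e(2) by (metis imageE subsetD)
  then show False
    using Im0[OF z] Im0[of y] e(1) by simp
qed

lemma linear_nonconstant:
  fixes b c :: complex
  assumes "c \<noteq> 0" "r > 0"
  shows "\<not> (\<lambda>z. (z - b) * c) constant_on ball w r"
proof
  assume "(\<lambda>z. (z - b) * c) constant_on ball w r"
  then obtain k where k: "\<And>z. z \<in> ball w r \<Longrightarrow> (z - b) * c = k"
    by (auto simp: constant_on_def)
  have "(w + of_real (r/2) - b) * c = (w - b) * c"
    using assms(2) by (intro k[THEN trans] k[symmetric]) (simp_all add: dist_norm)
  then show False
    using assms by simp
qed

text \<open>A nonconstant holomorphic function of the coordinate \<open>m\<close> on a small disc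
  cannot be real throughout, so every point of \<open>D\<close> is a limit of points with nonreal
  value; density of \<open>D\<close> does the rest. The radius \<open>r\<close> may be assumed to
  keep the disc inside \<open>D\<close>, and passing to \<open>s\<close> serves functions known to
  be holomorphic only close to the centre.\<close>

lemma open_dense_Im_nonzero:
  fixes h :: "complex ^ 'n \<Rightarrow> complex"
  assumes D: "open_dense D" and cont: "continuous_on D h"
    and var: "\<And>x. x \<in> D \<Longrightarrow> \<exists>m. \<forall>r>0. (\<forall>z\<in>ball (x $ m) r. vec_upd x m z \<in> D) \<longrightarrow>
               (\<exists>s>0. s \<le> r \<and> (\<lambda>z. h (vec_upd x m z)) holomorphic_on ball (x $ m) s \<and>
                 \<not> (\<lambda>z. h (vec_upd x m z)) constant_on ball (x $ m) s)"
  shows "open_dense {x \<in> D. Im (h x) \<noteq> 0}"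
proof -
  let ?U = "{x \<in> D. Im (h x) \<noteq> 0}"
  have "open (D \<inter> (\<lambda>x. Im (h x)) -` (- {0}))"
    using D cont by (intro continuous_open_preimage continuous_intros) (auto simp: open_dense_def)
  also have "D \<inter> (\<lambda>x. Im (h x)) -` (- {0}) = ?U"
    by auto
  finally have "open ?U" .
  moreover have "D \<subseteq> closure ?U"
  proof
    fix x assume x: "x \<in> D"
    obtain m where m: "\<And>r. r > 0 \<Longrightarrow> \<forall>z\<in>ball (x $ m) r. vec_upd x m z \<in> D \<Longrightarrow>
               (\<exists>s>0. s \<le> r \<and> (\<lambda>z. h (vec_upd x m z)) holomorphic_on ball (x $ m) s \<and>
                 \<not> (\<lambda>z. h (vec_upd x m z)) constant_on ball (x $ m) s)"
      using var[OF x] by blast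
    show "x \<in> closure ?U"
      unfolding closure_approachable
    proof (intro allI impI)
      fix e :: real assume e: "e > 0"
      obtain r where r: "r > 0" "ball x r \<subseteq> D"
        using D x by (meson open_contains_ball open_dense_def)
      \<comment> \<open>Changing one coordinate moves the vector exactly as far as that coordinate,
        so the disc stays inside \<open>ball x r\<close>.\<close>
      have D': "vec_upd x m z \<in> D" if "z \<in> ball (x $ m) (min e r)" for z
        using that r(2) by (auto simp: dist_vec_upd[symmetric])
      have "min e r > 0"
        using e r by simp
      from m[OF this] D' obtain s where s: "s > 0" "s \<le> min e r"
        "(\<lambda>z. h (vec_upd x m z)) holomorphic_on ball (x $ m) s"
        "\<not> (\<lambda>z. h (vec_upd x m z)) constant_on ball (x $ m) s"
        by blast
      obtain z where z: "z \<in> ball (x $ m) s" "Im (h (vec_upd x m z)) \<noteq> 0"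
        using real_holomorphic_constant[OF s(3)] s(4) by auto
      have "vec_upd x m z \<in> ?U"
        using z s(2) D' by (auto simp: )
      moreover have "dist (vec_upd x m z) x < e"
        using z(1) s(2) dist_vec_upd[of x m z] by (simp add: dist_commute)
      ultimately show "\<exists>y\<in>?U. dist y x < e"
        by blast
    qed
  qed
  ultimately show ?thesis
    using D closure_minimal[of D "closure ?U"] by (auto simp: open_dense_def)
qed

section \<open>Nonconstancy in one complex variable\<close>

text \<open>Clearing denominators in an equation with constant value \<open>b\<close> gives a
  polynomial with infinitely many roots, hence zero. At \<open>e i\<close> all its terms contain the
  factor \<open>e i - e i\<close> except the one with coefficient \<open>c i\<close>, which does not
  vanish there.\<close>

lemma sum_simple_poles_nonconstant:
  fixes e c :: "'i \<Rightarrow> complex"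
  assumes J: "finite J" "J \<noteq> {}" and inj: "inj_on e J" and c: "\<And>j. j \<in> J \<Longrightarrow> c j \<noteq> 0"
    and S: "infinite S" "S \<inter> e ` J = {}"
  shows "\<not> (\<lambda>z. \<Sum>j\<in>J. c j / (e j - z)) constant_on S"
proof
  assume "(\<lambda>z. \<Sum>j\<in>J. c j / (e j - z)) constant_on S"
  then obtain b where b: "\<And>z. z \<in> S \<Longrightarrow> (\<Sum>j\<in>J. c j / (e j - z)) = b"
    by (auto simp: constant_on_def)
  define p where "p = (\<Sum>j\<in>J. smult (c j) (\<Prod>k\<in>J-{j}. [:e k, -1:])) - smult b (\<Prod>k\<in>J. [:e k, -1:])"
  have poly_p: "poly p z = (\<Sum>j\<in>J. c j * (\<Prod>k\<in>J-{j}. e k - z)) - b * (\<Prod>k\<in>J. e k - z)" for z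
    by (simp add: p_def poly_sum poly_prod)
  have "poly p z = 0" if z: "z \<in> S" for z
  proof -
    have ne: "e k - z \<noteq> 0" if "k \<in> J" for k
      using S(2) z that by auto
    have "b * (\<Prod>k\<in>J. e k - z) = (\<Sum>j\<in>J. c j / (e j - z) * (\<Prod>k\<in>J. e k - z))"
      unfolding b[OF z, symmetric] by (rule sum_distrib_right)
    also have "\<dots> = (\<Sum>j\<in>J. c j * (\<Prod>k\<in>J-{j}. e k - z))"
      using J(1) ne by (intro sum.cong refl) (simp add: prod.remove)
    finally show ?thesis
      by (simp add: poly_p)
  qed
  then have "p = 0"
    using S(1) poly_roots_finite[of p] finite_subset[of S "{z. poly p z = 0}"] by blast
  obtain i where i: "i \<in> J"
    using J by blast
  have "(\<Sum>j\<in>J. c j * (\<Prod>k\<in>J-{j}. e k - e i)) = (\<Sum>j\<in>{i}. c j * (\<Prod>k\<in>J-{j}. e k - e i))"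
    using J(1) i by (intro sum.mono_neutral_right) (auto intro!: prod_zero)
  moreover have "(\<Prod>k\<in>J. e k - e i) = 0"
    using J(1) i by (intro prod_zero) auto
  ultimately have "poly p (e i) = c i * (\<Prod>k\<in>J-{i}. e k - e i)"
    by (simp add: poly_p)
  moreover have "\<dots> \<noteq> 0"
    using J(1) i c inj by (auto simp: inj_on_def)
  ultimately show False
    using \<open>p = 0\<close> by simp
qed

text \<open>The segment is compact, so it has positive distance \<open>s\<close> from
  \<open>A\<close>; its Minkowski sum with the ball of radius \<open>s\<close> is open and convex
  and misses \<open>A\<close>.\<close>

lemma convex_open_nbhd_segment:
  fixes z p :: complex
  assumes "closed A" "closed_segment z p \<inter> A = {}"
  obtains N s where "s > 0" "open N" "convex N" "ball z s \<subseteq> N" "p \<in> N" "N \<inter> A = {}"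
proof -
  obtain s where s: "s > 0" "\<forall>x\<in>closed_segment z p. \<forall>y\<in>A. s \<le> dist x y"
    using separate_compact_closed[OF _ assms] by auto
  define N where "N = (\<Union>x\<in>closed_segment z p. \<Union>y\<in>ball 0 s. {x + y})"
  have "open N" "convex N"
    unfolding N_def by (simp add: open_sums) (simp add: convex_sums)
  moreover have "x + y \<in> N" if "x \<in> closed_segment z p" "norm y < s" for x y
  proof -
    have "x + y \<in> (\<Union>y\<in>ball 0 s. {x + y})"
      using that by (intro UN_I[of y]) auto
    then show ?thesis
      using that unfolding N_def by blast
  qed
  \<comment> \<open>A point of the ball around \<open>z\<close> is \<open>z\<close> plus a short
    vector; the endpoint \<open>p\<close> is \<open>p + 0\<close>.\<close>
  from this[of z "_ - z"] this[of p 0] have "ball z s \<subseteq> N" "p \<in> N"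
    using s(1) by (auto simp: dist_norm norm_minus_commute)
  moreover have "N \<inter> A = {}"
  proof -
    have "x + y \<notin> A" if "x \<in> closed_segment z p" "norm y < s" for x y
      using s(2) that by (force simp: dist_norm)
    then show ?thesis
      unfolding N_def by auto
  qed
  ultimately show thesis
    using that s(1) by blast
qed

text \<open>With \<open>F' = T\<close> and \<open>G' = F\<close> on a convex neighbourhood of the
  segment, integration by parts gives \<open>H\<close> in closed form and
  \<open>H' z = F z - F p - \<beta>\<close>. If \<open>H\<close> were constant, \<open>F\<close>
  would be constant near \<open>z0\<close>, against \<open>F' z0 = T z0 \<noteq> 0\<close>.\<close>

lemma segment_integral_nonaffine:
  fixes T :: "complex \<Rightarrow> complex" and \<alpha> \<beta> :: complex
  assumes A: "closed A" and T: "T holomorphic_on -A" and seg: "closed_segment z0 p \<inter> A = {}"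
    and T0: "T z0 \<noteq> 0" and "r > 0"
  defines "H \<equiv> \<lambda>z. contour_integral (linepath z p) (\<lambda>w. (w - z) * T w) - (\<alpha> + \<beta> * z)"
  shows "\<exists>s>0. s \<le> r \<and> H holomorphic_on ball z0 s \<and> \<not> H constant_on ball z0 s"
proof -
  obtain N s0 where N: "s0 > 0" "open N" "convex N" "ball z0 s0 \<subseteq> N" "p \<in> N" "N \<inter> A = {}"
    using convex_open_nbhd_segment[OF A seg] .
  define s where "s = min r s0"
  define B where "B = ball z0 s"
  have B: "open B" "B \<subseteq> N" "z0 \<in> B" "connected B"
    using N \<open>r > 0\<close> by (auto simp: B_def s_def)
  have "T holomorphic_on N"
    using T N(6) by (rule_tac holomorphic_on_subset[OF T]) auto
  then obtain F where "\<And>x. x \<in> N \<Longrightarrow> (F has_field_derivative T x) (at x within N)"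
    using holomorphic_convex_primitive'[OF N(3,2)] by blast
  then have F: "(F has_field_derivative T x) (at x)" if "x \<in> N" for x
    using that at_within_open[OF that N(2)] by metis
  have "F holomorphic_on N"
    using F N(2) holomorphic_on_open by blast
  then obtain G where "\<And>x. x \<in> N \<Longrightarrow> (G has_field_derivative F x) (at x within N)"
    using holomorphic_convex_primitive'[OF N(3,2)] by blast
  then have G: "(G has_field_derivative F x) (at x)" if "x \<in> N" for x
    using that at_within_open[OF that N(2)] by metis
  have H: "H z = (p - z) * F p - G p + G z - (\<alpha> + \<beta> * z)" if z: "z \<in> B" for z
  proof -
    \<comment> \<open>Integration by parts: the two terms \<open>F w\<close> arising from the
      product and from \<open>G\<close> cancel.\<close>
    have "((\<lambda>w. (w - z) * F w - G w) has_field_derivative (w - z) * T w) (at w within N)"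
      if "w \<in> N" for w
      by (rule has_field_derivative_at_within)
        (use F[OF that] G[OF that] in \<open>auto intro!: derivative_eq_intros\<close>)
    moreover have "path_image (linepath z p) \<subseteq> N"
      using N(3,5) B(2) z closed_segment_subset[of z N p] by auto
    ultimately have "((\<lambda>w. (w - z) * T w) has_contour_integral
        ((p - z) * F p - G p) - ((z - z) * F z - G z)) (linepath z p)"
      using contour_integral_primitive[where S = N and f = "\<lambda>w. (w - z) * F w - G w" and g = "linepath z p"]
      by simp
    from contour_integral_unique[OF this] show ?thesis
      unfolding H_def by simp
  qed
  have dH: "(H has_field_derivative F z - F p - \<beta>) (at z)" if z: "z \<in> B" for z
  proof -
    have "((\<lambda>z. (p - z) * F p - G p + G z - (\<alpha> + \<beta> * z)) has_field_derivative F z - F p - \<beta>) (at z)"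
      using G[of z] B(2) z by (auto intro!: derivative_eq_intros)
    then show ?thesis
      by (rule has_field_derivative_transform_within_open[OF _ B(1) z]) (simp add: H)
  qed
  have "\<not> H constant_on B"
  proof
    assume "H constant_on B"
    then obtain c where c: "\<And>z. z \<in> B \<Longrightarrow> H z = c"
      by (auto simp: constant_on_def)
    have F': "F z = F p + \<beta>" if z: "z \<in> B" for z
    proof -
      have "((\<lambda>_. c) has_field_derivative F z - F p - \<beta>) (at z)"
        by (rule has_field_derivative_transform_within_open[OF dH[OF z] B(1) z]) (rule c)
      from DERIV_unique[OF this DERIV_const] show ?thesis
        by (simp add: algebra_simps)
    qed
    have "((\<lambda>_. F p + \<beta>) has_field_derivative T z0) (at z0)"
      by (rule has_field_derivative_transform_within_open[OF F B(1,3)]) (use B F' in auto)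
    from DERIV_unique[OF this DERIV_const] T0 show False
      by simp
  qed
  moreover have "H holomorphic_on B"
    using dH B(1) holomorphic_on_open by blast
  ultimately show ?thesis
    using \<open>r > 0\<close> N(1) unfolding B_def by (intro exI[of _ s]) (auto simp: s_def)
qed

section \<open>Simple roots and explicit residues of the field\<close>

text \<open>At the root \<open>e j\<close> the derivative equals the product of the other factors
  times \<open>a\<close>, which is nonzero by injectivity.\<close>

lemma rsquarefree_smult_prod_linear:
  assumes "finite I" "inj_on e I" "(a :: 'a :: field_char_0) \<noteq> 0"
  shows "rsquarefree (smult a (\<Prod>j\<in>I. [:- e j, 1:]))"
  unfolding rsquarefree_roots
proof (intro allI notI, elim conjE)
  fix x
  let ?p = "\<lambda>I. smult a (\<Prod>j\<in>I. [:- e j, 1:])"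
  assume x: "poly (?p I) x = 0" "poly (pderiv (?p I)) x = 0"
  then obtain j where j: "j \<in> I" "x = e j"
    using assms by (auto simp: poly_prod)
  have "?p I = [:- e j, 1:] * ?p (I - {j})"
    using assms(1) j by (simp add: prod.remove)
  then have "poly (pderiv (?p I)) x = poly (?p (I - {j})) x"
    by (simp only: pderiv_mult) (simp add: j pderiv_pCons)
  also have "\<dots> \<noteq> 0"
    using assms j by (auto simp: poly_prod inj_on_def)
  finally show False
    using x by simp
qed

text \<open>The identity includes the zeros of the denominator polynomial of the field: there both
  sides are 0, by the convention \<open>x / 0 = 0\<close>.\<close>

lemma inverse_fieldf:
  "1 / fieldf a d e p w = (\<Prod>i\<in>{1..d-2}. w - p i) / (a * (\<Prod>i\<in>{1..d}. w - e i))"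
  by (simp add: fieldf_def numP_def denQ_def poly_prod)

text \<open>Writing the field as \<open>(w - e j) * R w\<close> with \<open>R\<close> differentiable
  at \<open>e j\<close>, the product rule gives the derivative \<open>R (e j)\<close>.\<close>

lemma eta_eq:
  assumes j: "j \<in> {1..d}" and "e j \<notin> p ` {1..d-2}"
  shows "eta a d e p j = (\<Prod>i\<in>{1..d-2}. e j - p i) / (a * (\<Prod>i\<in>{1..d}-{j}. e j - e i))"
proof -
  let ?R = "\<lambda>w. (a * (\<Prod>i\<in>{1..d}-{j}. w - e i)) / (\<Prod>i\<in>{1..d-2}. w - p i)"
  \<comment> \<open>Because \<open>x / 0 = 0\<close>, the factorisation holds for every
    \<open>w\<close>, poles included, so it is an equation between functions.\<close>
  have "fieldf a d e p = (\<lambda>w. (w - e j) * ?R w)"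
  proof
    fix w
    have "(\<Prod>i\<in>{1..d}. w - e i) = (w - e j) * (\<Prod>i\<in>{1..d}-{j}. w - e i)"
      using j by (intro prod.remove) auto
    then show "fieldf a d e p w = (w - e j) * ?R w"
      by (simp add: fieldf_def numP_def denQ_def poly_prod)
  qed
  moreover have "?R field_differentiable at (e j)"
  proof (rule holomorphic_on_imp_differentiable_at)
    show "open (- (p ` {1..d-2}))"
      by (simp add: finite_imp_closed open_Compl)
    show "?R holomorphic_on - (p ` {1..d-2})"
      by (intro holomorphic_intros) auto
  qed (use assms in auto)
  then obtain D where D: "(?R has_field_derivative D) (at (e j))"
    by (auto simp: field_differentiable_def)
  have "((\<lambda>w. w - e j) has_field_derivative 1) (at (e j))"
    by (auto intro!: derivative_eq_intros)
  from DERIV_mult[OF this D]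
  have "((\<lambda>w. (w - e j) * ?R w) has_field_derivative 1 * ?R (e j) + D * (e j - e j)) (at (e j))"
    .
  from DERIV_imp_deriv[OF this]
  have "deriv (\<lambda>w. (w - e j) * ?R w) (e j) = ?R (e j)"
    by simp
  ultimately show ?thesis
    by (simp add: eta_def)
qed

section \<open>Configurations as vectors\<close>

text \<open>The space of configurations is \<open>complex ^ 'n\<close>, with coordinates enumerated
  by \<iota>. Slots \<open>0\<close> to \<open>d - 1\<close> hold the zeros numbered
  \<open>1\<close> to \<open>d\<close>; the following slots, from \<open>d\<close> to
  \<open>2*d - 3\<close>, hold the poles numbered \<open>1\<close> to \<open>d - 2\<close>.\<close>

locale configuration =
  fixes d :: nat and a :: complex and \<iota> :: "nat \<Rightarrow> 'n::finite"
  assumes d: "d \<ge> 2" and a: "a \<noteq> 0" and bij: "bij_betw \<iota> {..<2*d-2} UNIV"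
begin

definition zero_index :: "nat \<Rightarrow> 'n" where
  "zero_index j = \<iota> (j - 1)"

definition pole_index :: "nat \<Rightarrow> 'n" where
  "pole_index k = \<iota> (d + k - 1)"

definition zero :: "complex ^ 'n \<Rightarrow> nat \<Rightarrow> complex" where
  "zero x j = x $ zero_index j"

definition pole :: "complex ^ 'n \<Rightarrow> nat \<Rightarrow> complex" where
  "pole x j = x $ pole_index j"

text \<open>The coefficient \<open>1 / f\<close> of the differential form \<open>dw / f\<close>,
  with the dependence on each coordinate of \<open>x\<close> made visible.\<close>

definition form :: "complex ^ 'n \<Rightarrow> complex \<Rightarrow> complex" where
  "form x w = (\<Prod>i\<in>{1..d-2}. w - pole x i) / (a * (\<Prod>i\<in>{1..d}. w - zero x i))"

text \<open>For distinct zeros and poles this is \<open>1 / f'(e_j)\<close>, the residue of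
  \<open>dw / f\<close> at the zero numbered \<open>j\<close>.\<close>

definition res :: "complex ^ 'n \<Rightarrow> nat \<Rightarrow> complex" where
  "res x j = (\<Prod>i\<in>{1..d-2}. zero x j - pole x i) / (a * (\<Prod>i\<in>{1..d}-{j}. zero x j - zero x i))"

definition distinct_configs :: "(complex ^ 'n) set" where
  "distinct_configs = {x. \<forall>i j. i \<noteq> j \<longrightarrow> x $ i \<noteq> x $ j}"

text \<open>A nonzero imaginary part says that the quotient of the two differences is not real. The
  conjugate is harmless for holomorphy, since only the zero will be varied and the conjugated factor
  depends on poles alone.\<close>

definition noncollinear_configs :: "(complex ^ 'n) set" where
  "noncollinear_configs = distinct_configs \<inter>
    (\<Inter>(j, k, l)\<in>{(j, k, l). j \<in> {1..d} \<and> k \<in> {1..d-2} \<and> l \<in> {1..d-2} \<and> k \<noteq> l}.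
      {x \<in> distinct_configs. Im ((zero x j - pole x k) * cnj (pole x l - pole x k)) \<noteq> 0})"

lemma index_eq_iff:
  "i \<in> {1..d} \<Longrightarrow> j \<in> {1..d} \<Longrightarrow> zero_index i = zero_index j \<longleftrightarrow> i = j"
  "k \<in> {1..d-2} \<Longrightarrow> l \<in> {1..d-2} \<Longrightarrow> pole_index k = pole_index l \<longleftrightarrow> k = l"
  "j \<in> {1..d} \<Longrightarrow> k \<in> {1..d-2} \<Longrightarrow> zero_index j \<noteq> pole_index k"
proof -
  have inj: "\<iota> i = \<iota> j \<longleftrightarrow> i = j" if "i < 2*d-2" "j < 2*d-2" for i j
    using bij that by (auto simp: bij_betw_def inj_on_def)
  show "i \<in> {1..d} \<Longrightarrow> j \<in> {1..d} \<Longrightarrow> zero_index i = zero_index j \<longleftrightarrow> i = j"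
    unfolding zero_index_def pole_index_def using d by (subst inj) auto
  show "k \<in> {1..d-2} \<Longrightarrow> l \<in> {1..d-2} \<Longrightarrow> pole_index k = pole_index l \<longleftrightarrow> k = l"
    unfolding zero_index_def pole_index_def using d by (subst inj) auto
  show "j \<in> {1..d} \<Longrightarrow> k \<in> {1..d-2} \<Longrightarrow> zero_index j \<noteq> pole_index k"
    unfolding zero_index_def pole_index_def using d by (subst inj) auto
qed

lemma zero_upd_zero:
  assumes "i \<in> {1..d}" "j \<in> {1..d}"
  shows "zero (vec_upd x (zero_index i) z) j = (if j = i then z else zero x j)"
  by (simp only: zero_def vec_upd_nth index_eq_iff assms)

lemma pole_upd_zero:
  assumes "i \<in> {1..d}" "k \<in> {1..d-2}"
  shows "pole (vec_upd x (zero_index i) z) k = pole x k"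
  by (simp only: pole_def vec_upd_nth index_eq_iff(3)[THEN not_sym] assms if_False)

lemma zero_upd_pole:
  assumes "k \<in> {1..d-2}" "j \<in> {1..d}"
  shows "zero (vec_upd x (pole_index k) z) j = zero x j"
  by (simp only: zero_def vec_upd_nth index_eq_iff assms if_False)

lemma pole_upd_pole:
  assumes "k \<in> {1..d-2}" "l \<in> {1..d-2}"
  shows "pole (vec_upd x (pole_index k) z) l = (if l = k then z else pole x l)"
  by (simp only: pole_def vec_upd_nth index_eq_iff assms)

lemma zero_eq_iff:
  assumes "x \<in> distinct_configs" "i \<in> {1..d}" "j \<in> {1..d}"
  shows "zero x i = zero x j \<longleftrightarrow> i = j"
  using assms(1) index_eq_iff(1)[OF assms(2,3)] unfolding zero_def distinct_configs_def by auto

lemma pole_eq_iff: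
  assumes "x \<in> distinct_configs" "k \<in> {1..d-2}" "l \<in> {1..d-2}"
  shows "pole x k = pole x l \<longleftrightarrow> k = l"
  using assms(1) index_eq_iff(2)[OF assms(2,3)] unfolding pole_def distinct_configs_def by auto

lemma zero_neq_pole:
  assumes "x \<in> distinct_configs" "j \<in> {1..d}" "k \<in> {1..d-2}"
  shows "zero x j \<noteq> pole x k"
  using assms(1) index_eq_iff(3)[OF assms(2,3)]
  unfolding zero_def pole_def distinct_configs_def by auto

lemma continuous_zero [continuous_intros]:
  "continuous_on S f \<Longrightarrow> continuous_on S (\<lambda>x. zero (f x) j)"
  unfolding zero_def by (intro continuous_intros)

lemma continuous_pole [continuous_intros]:
  "continuous_on S f \<Longrightarrow> continuous_on S (\<lambda>x. pole (f x) j)"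
  unfolding pole_def by (intro continuous_intros)

section \<open>Distinct and noncollinear configurations\<close>

text \<open>For each pair of coordinates the difference is already nonreal, hence nonzero, on an
  open dense set, and there are finitely many pairs.\<close>

lemma open_dense_distinct: "open_dense distinct_configs"
proof -
  have "open_dense {x :: complex ^ 'n. x $ i \<noteq> x $ j}" if "i \<noteq> j" for i j :: 'n
  proof -
    have "open_dense {x \<in> UNIV. Im (x $ i - x $ j) \<noteq> 0}"
    proof (rule open_dense_Im_nonzero, goal_cases)
      case (3 x)
      have "\<not> (\<lambda>z. z - x $ j) constant_on ball (x $ i) r" if "r > 0" for r
        using linear_nonconstant[OF one_neq_zero that, of "x $ j" "x $ i"] by simp
      moreover have "(\<lambda>z. z - x $ j) holomorphic_on ball (x $ i) r" for r
        by (intro holomorphic_intros)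
      moreover have "vec_upd x i z $ i - vec_upd x i z $ j = z - x $ j" for z
        using that by simp
      ultimately show ?case
        by (intro exI[of _ i]) auto
    qed (auto simp: open_dense_def intro!: continuous_intros)
    moreover have "{x \<in> UNIV. Im (x $ i - x $ j) \<noteq> 0} \<subseteq> {x. x $ i \<noteq> x $ j}"
      by auto
    moreover have "open {x :: complex ^ 'n. x $ i \<noteq> x $ j}"
      by (intro open_Collect_neq continuous_intros)
    ultimately show ?thesis
      by (rule open_dense_superset)
  qed
  then have "open_dense (\<Inter>(i, j)\<in>{(i, j). i \<noteq> j}. {x :: complex ^ 'n. x $ i \<noteq> x $ j})"
    by (intro open_dense_INT) auto
  also have "(\<Inter>(i, j)\<in>{(i, j). i \<noteq> j}. {x :: complex ^ 'n. x $ i \<noteq> x $ j}) = distinct_configs"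
    by (auto simp: distinct_configs_def)
  finally show ?thesis .
qed

text \<open>As a function of the moving zero the product is affine, with slope the conjugate of the
  difference of two distinct poles.\<close>

lemma open_dense_noncollinear: "open_dense noncollinear_configs"
proof -
  let ?I = "{(j, k, l). j \<in> {1..d} \<and> k \<in> {1..d-2} \<and> l \<in> {1..d-2} \<and> k \<noteq> l}"
  have "finite ?I"
    by (rule finite_subset[of _ "{1..d} \<times> {1..d-2} \<times> {1..d-2}"]) auto
  moreover have "open_dense {x \<in> distinct_configs. Im ((zero x j - pole x k) * cnj (pole x l - pole x k)) \<noteq> 0}"
    if j: "j \<in> {1..d}" and k: "k \<in> {1..d-2}" and l: "l \<in> {1..d-2}" and "k \<noteq> l" for j k l
  proof (rule open_dense_Im_nonzero[OF open_dense_distinct], goal_cases)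
    case (2 x)
    let ?c = "cnj (pole x l - pole x k)"
    let ?h = "\<lambda>z. (z - pole x k) * ?c"
    have c: "?c \<noteq> 0"
      using pole_eq_iff[OF 2 l k] \<open>k \<noteq> l\<close> by simp
    have "\<not> ?h constant_on ball (zero x j) r" if "r > 0" for r
      using linear_nonconstant[OF c that] .
    moreover have "?h holomorphic_on ball (zero x j) r" for r
      by (intro holomorphic_intros)
    ultimately show ?case
      using j k l by (intro exI[of _ "zero_index j"])
        (auto simp: zero_upd_zero pole_upd_zero simp flip: zero_def)
  qed (intro continuous_intros)
  ultimately have "open_dense (\<Inter>(j, k, l)\<in>?I.
      {x \<in> distinct_configs. Im ((zero x j - pole x k) * cnj (pole x l - pole x k)) \<noteq> 0})"
    by (intro open_dense_INT) auto
  then show ?thesis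
    unfolding noncollinear_configs_def by (intro open_dense_Int open_dense_distinct)
qed

text \<open>On the line the product in the definition becomes \<open>t\<close> times a squared
  modulus, which is real.\<close>

lemma zero_not_on_pole_line:
  assumes x: "x \<in> noncollinear_configs" and "j \<in> {1..d}" "k \<in> {1..d-2}" "l \<in> {1..d-2}" "k \<noteq> l"
  shows "zero x j \<noteq> pole x k + complex_of_real t * (pole x l - pole x k)"
proof
  assume eq: "zero x j = pole x k + complex_of_real t * (pole x l - pole x k)"
  have "Im ((zero x j - pole x k) * cnj (pole x l - pole x k)) \<noteq> 0"
    using assms unfolding noncollinear_configs_def by blast
  moreover have "(zero x j - pole x k) * cnj (pole x l - pole x k) =
      complex_of_real (t * (cmod (pole x l - pole x k))\<^sup>2)"
    by (simp only: eq of_real_mult complex_norm_square) (simp add: algebra_simps)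
  ultimately show False
    by (simp only: Im_complex_of_real)
qed

lemma linepath_neq_zero:
  assumes "x \<in> noncollinear_configs" "j \<in> {1..d}" "k \<in> {1..d-2}" "l \<in> {1..d-2}" "k \<noteq> l"
  shows "linepath (pole x k) (pole x l) t \<noteq> zero x j"
  using zero_not_on_pole_line[OF assms, of t]
  by (simp add: linepath_def scaleR_conv_of_real algebra_simps)

lemma continuous_res: "j \<in> {1..d} \<Longrightarrow> continuous_on distinct_configs (\<lambda>x. res x j)"
  unfolding res_def using a by (intro continuous_intros) (auto simp: zero_eq_iff)

lemma noncollinear_subset: "noncollinear_configs \<subseteq> distinct_configs"
  by (auto simp: noncollinear_configs_def)

section \<open>Partial sums of residues\<close>

text \<open>Since \<open>J\<close> is a proper subset, some zero with index \<open>i\<close> outside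
  \<open>J\<close> can be moved. It enters each residue over \<open>J\<close> through a single
  factor of the denominator, so the sum becomes a sum of simple poles at the zeros in
  \<open>J\<close>.\<close>

lemma open_dense_Re_sum_res:
  assumes J: "J \<noteq> {}" "J \<subset> {1..d}"
  shows "open_dense {x \<in> distinct_configs. Re (\<Sum>j\<in>J. res x j) \<noteq> 0}"
proof -
  have "finite J"
    using J(2) finite_subset by blast
  obtain i where i: "i \<in> {1..d}" "i \<notin> J"
    using J by blast
  \<comment> \<open>The factor \<open>\<i>\<close> turns the real part into an imaginary
    part.\<close>
  have "open_dense {x \<in> distinct_configs. Im (\<i> * (\<Sum>j\<in>J. res x j)) \<noteq> 0}"
  proof (rule open_dense_Im_nonzero[OF open_dense_distinct], goal_cases)
    case 1
    show ?case
      using J by (intro continuous_intros continuous_res) auto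
  next
    case (2 x)
    \<comment> \<open>\<open>c j\<close> is \<open>\<i>\<close> times the residue with the factor of
      the moving zero removed from its denominator.\<close>
    define c where "c j = \<i> * (\<Prod>i\<in>{1..d-2}. zero x j - pole x i) /
      (a * (\<Prod>k\<in>{1..d}-{j}-{i}. zero x j - zero x k))" for j
    have "c j \<noteq> 0" if "j \<in> J" for j
    proof -
      have j: "j \<in> {1..d}"
        using that J by auto
      have "zero x j \<noteq> pole x k" if "k \<in> {1..d-2}" for k
        by (rule zero_neq_pole[OF 2 j that])
      moreover have "zero x j \<noteq> zero x k" if "k \<in> {1..d}-{j}" for k
        using that zero_eq_iff[OF 2 j, of k] by auto
      ultimately show ?thesis
        using a by (simp add: c_def)
    qed
    have upd: "\<i> * (\<Sum>j\<in>J. res (vec_upd x (zero_index i) z) j) = (\<Sum>j\<in>J. c j / (zero x j - z))" for z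
      unfolding sum_distrib_left
    proof (intro sum.cong refl)
      fix j assume j: "j \<in> J"
      have "(\<Prod>k\<in>{1..d}-{j}. zero x j - zero (vec_upd x (zero_index i) z) k) =
          (zero x j - z) * (\<Prod>k\<in>{1..d}-{j}-{i}. zero x j - zero x k)"
        using i j by (subst prod.remove[of _ i]) (auto simp: zero_upd_zero)
      moreover have "zero (vec_upd x (zero_index i) z) j = zero x j"
        using i j J by (subst zero_upd_zero) auto
      ultimately show "\<i> * res (vec_upd x (zero_index i) z) j = c j / (zero x j - z)"
        using i by (simp add: res_def c_def pole_upd_zero)
    qed
    have "\<exists>s>0. s \<le> r \<and>
        (\<lambda>z. \<Sum>j\<in>J. c j / (zero x j - z)) holomorphic_on ball (x $ zero_index i) s \<and>
        \<not> (\<lambda>z. \<Sum>j\<in>J. c j / (zero x j - z)) constant_on ball (x $ zero_index i) s"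
      if r: "r > 0" "\<forall>z\<in>ball (x $ zero_index i) r. vec_upd x (zero_index i) z \<in> distinct_configs" for r
    proof -
      \<comment> \<open>Staying among distinct configurations keeps the moving zero away from the
        poles of the sum.\<close>
      have ne: "zero x j \<noteq> z" if "z \<in> ball (x $ zero_index i) r" "j \<in> J" for j z
        using zero_eq_iff[of "vec_upd x (zero_index i) z" i j] r(2) that i J
        by (auto simp: zero_upd_zero)
      have "(\<lambda>z. \<Sum>j\<in>J. c j / (zero x j - z)) holomorphic_on ball (x $ zero_index i) r"
        using ne by (intro holomorphic_intros) auto
      moreover have "\<not> (\<lambda>z. \<Sum>j\<in>J. c j / (zero x j - z)) constant_on ball (x $ zero_index i) r"
      proof (rule sum_simple_poles_nonconstant)
        show "inj_on (zero x) J"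
          using J zero_eq_iff[OF 2] unfolding inj_on_def by blast
        show "infinite (ball (x $ zero_index i) r)"
          using r(1) finite_imp_not_open[of "ball (x $ zero_index i) r"] by auto
        show "ball (x $ zero_index i) r \<inter> zero x ` J = {}"
          using ne by blast
      qed fact+
      ultimately show ?thesis
        using r(1) by auto
    qed
    then show ?case
      by (intro exI[of _ "zero_index i"] allI impI) (simp only: upd)
  qed
  then show ?thesis
    by simp
qed

section \<open>Integrals along segments between poles\<close>

text \<open>Parametrised over \<open>[0, 1]\<close>, the integrand is jointly continuous in
  configuration and parameter, because noncollinearity keeps the segment off the zeros of the
  field.\<close>

lemma continuous_segment_integral:
  assumes kl: "k \<in> {1..d-2}" "l \<in> {1..d-2}" "k \<noteq> l"
  shows "continuous_on noncollinear_configs (\<lambda>x. contour_integral (linepath (pole x k) (pole x l)) (form x))"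
proof -
  have eq: "contour_integral (linepath (pole x k) (pole x l)) (form x) =
      integral (cbox 0 1) (\<lambda>t. form x (linepath (pole x k) (pole x l) t) * (pole x l - pole x k))" for x
    unfolding contour_integral_integral box_real by (intro integral_cong) simp
  show ?thesis
    unfolding eq
  proof (rule integral_continuous_on_param)
    have "a * (\<Prod>i\<in>{1..d}. linepath (pole x k) (pole x l) t - zero x i) \<noteq> 0"
      if "x \<in> noncollinear_configs" for x t
      using a linepath_neq_zero[OF that _ kl] by simp
    then show "continuous_on (noncollinear_configs \<times> cbox 0 1)
        (\<lambda>(x, t). form x (linepath (pole x k) (pole x l) t) * (pole x l - pole x k))"
      unfolding form_def linepath_def split_beta by (intro continuous_intros) auto
  qed
qed

text \<open>The period is fixed by the integers \<open>n\<close>, and the pole numbered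
  \<open>k\<close> is moved to \<open>z\<close>. Both the form and the residues contain
  \<open>z\<close> in one linear factor only, so \<open>segment_integral_nonaffine\<close>
  applies.\<close>

lemma open_dense_segment_integral:
  fixes n :: "nat \<Rightarrow> int"
  assumes kl: "k \<in> {1..d-2}" "l \<in> {1..d-2}" "k \<noteq> l"
  shows "open_dense {x \<in> noncollinear_configs.
    Im (contour_integral (linepath (pole x k) (pole x l)) (form x) -
        2 * complex_of_real pi * \<i> * (\<Sum>j\<in>{1..d}. of_int (n j) * res x j)) \<noteq> 0}"
proof (rule open_dense_Im_nonzero[OF open_dense_noncollinear], goal_cases)
  case 1
  have "continuous_on noncollinear_configs (\<lambda>x. res x j)" if "j \<in> {1..d}" for j
    using continuous_res[OF that] noncollinear_subset by (rule continuous_on_subset)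
  then show ?case
    using kl by (intro continuous_intros continuous_segment_integral) auto
next
  case (2 x)
  then have x: "x \<in> distinct_configs"
    using noncollinear_subset by blast
  define m where "m = pole_index k"
  define T where "T w = (\<Prod>i\<in>{1..d-2}-{k}. w - pole x i) / (a * (\<Prod>i\<in>{1..d}. w - zero x i))" for w
  \<comment> \<open>Moving the pole to \<open>z\<close> makes the \<open>j\<close>-th summand of the
    period \<open>c j * (zero x j - z)\<close>; summing gives the affine function with coefficients
    \<alpha> and \<beta>.\<close>
  define c where "c j = 2 * complex_of_real pi * \<i> * of_int (n j) * (\<Prod>i\<in>{1..d-2}-{k}. zero x j - pole x i) /
    (a * (\<Prod>i\<in>{1..d}-{j}. zero x j - zero x i))" for j
  define \<alpha> where "\<alpha> = (\<Sum>j\<in>{1..d}. c j * zero x j)"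
  define \<beta> where "\<beta> = - (\<Sum>j\<in>{1..d}. c j)"
  have poles: "(\<Prod>i\<in>{1..d-2}. w - pole (vec_upd x m z) i) = (w - z) * (\<Prod>i\<in>{1..d-2}-{k}. w - pole x i)" for w z
    using kl by (subst prod.remove[of _ k]) (auto simp: m_def pole_upd_pole)
  have form: "form (vec_upd x m z) = (\<lambda>w. (w - z) * T w)" for z
    unfolding form_def poles T_def using kl by (simp add: m_def zero_upd_pole)
  have "2 * complex_of_real pi * \<i> * (\<Sum>j\<in>{1..d}. of_int (n j) * res (vec_upd x m z) j) =
      (\<Sum>j\<in>{1..d}. c j * (zero x j - z))" for z
    unfolding sum_distrib_left
  proof (intro sum.cong refl)
    fix j assume "j \<in> {1..d}"
    then show "2 * complex_of_real pi * \<i> * (of_int (n j) * res (vec_upd x m z) j) = c j * (zero x j - z)"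
      unfolding res_def poles c_def using kl by (simp add: m_def zero_upd_pole)
  qed
  then have sum: "2 * complex_of_real pi * \<i> * (\<Sum>j\<in>{1..d}. of_int (n j) * res (vec_upd x m z) j) =
      \<alpha> + \<beta> * z" for z
    by (simp add: \<alpha>_def \<beta>_def algebra_simps sum_subtractf sum_distrib_left)
  let ?H = "\<lambda>z. contour_integral (linepath z (pole x l)) (\<lambda>w. (w - z) * T w) - (\<alpha> + \<beta> * z)"
  have "\<exists>s>0. s \<le> r \<and> ?H holomorphic_on ball (pole x k) s \<and> \<not> ?H constant_on ball (pole x k) s"
    if "r > 0" for r
  proof (rule segment_integral_nonaffine[where A = "zero x ` {1..d}"])
    show "closed (zero x ` {1..d})"
      by (simp add: finite_imp_closed)
    show "T holomorphic_on - zero x ` {1..d}"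
      unfolding T_def using a by (intro holomorphic_intros) auto
    show "closed_segment (pole x k) (pole x l) \<inter> zero x ` {1..d} = {}"
      using linepath_neq_zero[OF 2 _ kl] by (fastforce simp flip: path_image_linepath simp: path_image_def)
    have "zero x j \<noteq> pole x k" if "j \<in> {1..d}" for j
      using zero_neq_pole[OF x that kl(1)] .
    moreover have "pole x i \<noteq> pole x k" if "i \<in> {1..d-2}-{k}" for i
      using pole_eq_iff[OF x _ kl(1)] that by auto
    \<comment> \<open>\<open>T\<close> lacks the factor vanishing at the moving pole, and the
      remaining poles differ from it.\<close>
    ultimately show "T (pole x k) \<noteq> 0"
      using a by (force simp: T_def)
  qed (rule that)
  moreover have "x $ m = pole x k"
    by (simp add: m_def pole_def)
  moreover have "pole (vec_upd x m z) k = z" "pole (vec_upd x m z) l = pole x l" for z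
    using kl by (auto simp: m_def pole_upd_pole)
  ultimately show ?case
    by (intro exI[of _ m]) (simp add: form sum del: One_nat_def)
qed

section \<open>The generic set and its nondegeneracy\<close>

text \<open>Integer coefficients are taken extensional on \<open>{1..d}\<close>, which leaves only countably many.\<close>

definition generic_configs :: "(complex ^ 'n) set" where
  "generic_configs = noncollinear_configs \<inter>
    (\<Inter>J\<in>{J. J \<noteq> {} \<and> J \<subset> {1..d}}. {x \<in> distinct_configs. Re (\<Sum>j\<in>J. res x j) \<noteq> 0}) \<inter>
    (\<Inter>(k, l, n)\<in>{(k, l, n). k \<in> {1..d-2} \<and> l \<in> {1..d-2} \<and> k \<noteq> l \<and> n \<in> {1..d} \<rightarrow>\<^sub>E (UNIV :: int set)}.
      {x \<in> noncollinear_configs. Im (contour_integral (linepath (pole x k) (pole x l)) (form x) -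
        2 * complex_of_real pi * \<i> * (\<Sum>j\<in>{1..d}. of_int (n j) * res x j)) \<noteq> 0})"

lemma generic_generic_configs: "generic generic_configs"
  unfolding generic_configs_def
proof (intro generic_Int generic_INT)
  show "generic noncollinear_configs"
    using open_dense_noncollinear unfolding generic_def open_dense_def
    by (intro exI[of _ "{noncollinear_configs}"]) auto
  show "countable {J. J \<noteq> {} \<and> J \<subset> {1..d}}"
    by (rule countable_finite, rule finite_subset[of _ "Pow {1..d}"]) auto
  have "countable ({1..d-2} \<times> {1..d-2} \<times> ({1..d} \<rightarrow>\<^sub>E (UNIV :: int set)))"
    by (intro countable_SIGMA countable_PiE) auto
  then show "countable {(k, l, n). k \<in> {1..d-2} \<and> l \<in> {1..d-2} \<and> k \<noteq> l \<and>
      n \<in> {1..d} \<rightarrow>\<^sub>E (UNIV :: int set)}"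
    by (rule countable_subset[rotated]) auto
  show "open_dense {x \<in> distinct_configs. Re (\<Sum>j\<in>J. res x j) \<noteq> 0}"
    if "J \<in> {J. J \<noteq> {} \<and> J \<subset> {1..d}}" for J
    using that open_dense_Re_sum_res by blast
  show "open_dense (case i of (k, l, n) \<Rightarrow> {x \<in> noncollinear_configs.
      Im (contour_integral (linepath (pole x k) (pole x l)) (form x) -
        2 * complex_of_real pi * \<i> * (\<Sum>j\<in>{1..d}. of_int (n j) * res x j)) \<noteq> 0})"
    if "i \<in> {(k, l, n). k \<in> {1..d-2} \<and> l \<in> {1..d-2} \<and> k \<noteq> l \<and>
      n \<in> {1..d} \<rightarrow>\<^sub>E (UNIV :: int set)}" for i
  proof -
    obtain k l n where i: "i = (k, l, n)"
      by (cases i)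
    then show ?thesis
      using that open_dense_segment_integral[of k l n] by simp
  qed
qed

text \<open>Distinctness identifies \<open>eta\<close> with \<open>res\<close>, so the open dense
  conditions become those on the field. If a segment integral lay in the reals plus a period,
  subtracting that period would leave a real number.\<close>

lemma nondegenerate_generic_configs:
  assumes x: "x \<in> generic_configs"
  shows "nondegenerate a d (zero x) (pole x)"
proof -
  have nc: "x \<in> noncollinear_configs"
    using x by (simp add: generic_configs_def)
  then have di: "x \<in> distinct_configs"
    using noncollinear_subset by blast
  have eta: "eta a d (zero x) (pole x) j = res x j" if "j \<in> {1..d}" for j
    unfolding res_def using zero_neq_pole[OF di that] by (intro eta_eq[OF that]) blast
  have form: "(\<lambda>w. 1 / fieldf a d (zero x) (pole x) w) = form x"
    by (simp add: fun_eq_iff inverse_fieldf form_def)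
  have "rsquarefree (numP a d (zero x))"
    unfolding numP_def using a zero_eq_iff[OF di]
    by (intro rsquarefree_smult_prod_linear) (auto simp: inj_on_def)
  moreover have "rsquarefree (denQ d (pole x))"
    using rsquarefree_smult_prod_linear[of "{1..d-2}" "pole x" 1] pole_eq_iff[OF di]
    by (auto simp: inj_on_def denQ_def)
  moreover have "zero x ` {1..d} \<inter> pole x ` {1..d-2} = {}"
    using zero_neq_pole[OF di] by blast
  moreover have "degree (denQ d (pole x)) = d - 2"
    unfolding denQ_def by (subst degree_prod_eq_sum_degree) auto
  moreover have "Re (\<Sum>j\<in>J. eta a d (zero x) (pole x) j) \<noteq> 0" if J: "J \<noteq> {}" "J \<subset> {1..d}" for J
  proof -
    have "(\<Sum>j\<in>J. eta a d (zero x) (pole x) j) = (\<Sum>j\<in>J. res x j)"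
      using J by (intro sum.cong refl eta) auto
    moreover have "x \<in> {x \<in> distinct_configs. Re (\<Sum>j\<in>J. res x j) \<noteq> 0}"
      using x J unfolding generic_configs_def by blast
    ultimately show ?thesis
      by simp
  qed
  moreover have "contour_integral (linepath (pole x k) (pole x l)) (form x)
      \<notin> realPlusPeriods a d (zero x) (pole x)"
    if kl: "k \<in> {1..d-2}" "l \<in> {1..d-2}" "k \<noteq> l" for k l
  proof
    assume "contour_integral (linepath (pole x k) (pole x l)) (form x)
      \<in> realPlusPeriods a d (zero x) (pole x)"
    then obtain r n where rn: "contour_integral (linepath (pole x k) (pole x l)) (form x) =
        complex_of_real r + 2 * complex_of_real pi * \<i> *
          (\<Sum>j\<in>{1..d}. of_int (n j) * eta a d (zero x) (pole x) j)"
      unfolding realPlusPeriods_def by blast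
    \<comment> \<open>Restriction makes the coefficients extensional, as the index set of the
      intersection demands, without changing the sum over \<open>{1..d}\<close>.\<close>
    define n' where "n' = restrict n {1..d}"
    have "(\<Sum>j\<in>{1..d}. of_int (n j) * eta a d (zero x) (pole x) j) =
        (\<Sum>j\<in>{1..d}. of_int (n' j) * res x j)"
      by (intro sum.cong refl) (simp add: eta n'_def)
    then have "contour_integral (linepath (pole x k) (pole x l)) (form x) -
        2 * complex_of_real pi * \<i> * (\<Sum>j\<in>{1..d}. of_int (n' j) * res x j) = complex_of_real r"
      using rn by simp
    moreover have "n' \<in> {1..d} \<rightarrow>\<^sub>E UNIV"
      by (simp add: n'_def)
    then have "(k, l, n') \<in> {(k, l, n). k \<in> {1..d-2} \<and> l \<in> {1..d-2} \<and> k \<noteq> l \<and>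
        n \<in> {1..d} \<rightarrow>\<^sub>E (UNIV :: int set)}"
      using kl by simp
    from INT_D[OF IntD2[OF x[unfolded generic_configs_def]] this]
    have "Im (contour_integral (linepath (pole x k) (pole x l)) (form x) -
        2 * complex_of_real pi * \<i> * (\<Sum>j\<in>{1..d}. of_int (n' j) * res x j)) \<noteq> 0"
      by simp
    ultimately show False
      by (metis Im_complex_of_real)
  qed
  ultimately show ?thesis
    unfolding nondegenerate_def form using d zero_not_on_pole_line[OF nc]
    by (intro conjI ballI allI impI) metis+
qed

end

theorem theorem2p1:
  fixes d :: nat and a :: complex and \<iota> :: "nat \<Rightarrow> 'n::finite"
  assumes "d \<ge> 2" and "a \<noteq> 0"
    and "bij_betw \<iota> {..<2*d-2} (UNIV :: 'n set)"
  shows "\<exists>E :: (complex ^ 'n) set. generic E \<and>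
           (\<forall>x\<in>E. nondegenerate a d (\<lambda>j. x $ \<iota> (j - 1)) (\<lambda>j. x $ \<iota> (d + j - 1)))"
proof -
  interpret configuration d a \<iota>
    by unfold_locales fact+
  show ?thesis
    using generic_generic_configs nondegenerate_generic_configs
    unfolding zero_def pole_def zero_index_def pole_index_def by blast
qed

end
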